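(* Let $q>0$ be real with $q\ne1$, and let $\alpha>-1$. For every positive integer $n$ and every constant $a_0\ne0$, the $q$-difference equation $$x\,D_{q,x}^2y(x)+(\alpha+1-x)\,D_{q,x}y(x)+[n]_q\,y(x)=0$$ has as a solution the polynomial $y_{L,m_q}(x)=\sum_{\nu=0}^na_\nu x^\nu$ with $$a_1=-\frac{[n]_q}{\alpha+1}a_0,\qquad a_\nu=-\frac{[n]_q}{\alpha+1}a_0\prod_{j=1}^{\nu-1}\left(\frac{[j]_q-[n]_q}{[j+1]_q\left([j]_q+\alpha+1\right)}\right)\quad\text{for }2\le\nu\le n.$$
   Context: $[j]_q=\frac{1-q^j}{1-q}$ for integers $j\ge0$. $D_{q,x}$ is the Jackson $q$-derivative $D_{q,x}f(x)=\frac{f(qx)-f(x)}{qx-x}$, which acts on polynomials by $D_{q,x}1=0$, $D_{q,x}x^k=[k]_qx^{k-1}$ for $k\ge1$; $D_{q,x}^2=D_{q,x}\circ D_{q,x}$. *)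

theory Defs
  imports "HOL-Analysis.Analysis"
begin

definition q_number :: "real \<Rightarrow> nat \<Rightarrow> real" where
  "q_number q j = (1 - q ^ j) / (1 - q)"

text \<open>
  The difference quotient is undefined at \<open>x = 0\<close>; there the usual convention
  \<open>D\<^sub>q f(0) = f'(0)\<close> is used. It is the value forced by the action on monomials,
  so for polynomials the operator is the expected one at every real \<open>x\<close>,
  as \<open>jackson_deriv_sum\<close> shows.
\<close>
definition jackson_deriv :: "real \<Rightarrow> (real \<Rightarrow> real) \<Rightarrow> real \<Rightarrow> real" where
  "jackson_deriv q f x =
     (if x = 0 then deriv f 0 else (f (q * x) - f x) / (q * x - x))"

lemma jackson_deriv_sum:
  assumes "q \<noteq> 1"
  shows "jackson_deriv q (\<lambda>x. \<Sum>k\<le>n. c k * x ^ k) =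
         (\<lambda>x. \<Sum>k\<le>n. c k * (q_number q k * x ^ (k - 1)))"
proof
  fix x :: real
  show "jackson_deriv q (\<lambda>x. \<Sum>k\<le>n. c k * x ^ k) x =
        (\<Sum>k\<le>n. c k * (q_number q k * x ^ (k - 1)))"
  proof (cases "x = 0")
    case True
    have "((\<lambda>x. \<Sum>k\<le>n. c k * x ^ k) has_field_derivative
            (\<Sum>k\<le>n. c k * (real k * 0 ^ (k - 1)))) (at 0)"
      by (auto intro!: derivative_eq_intros sum.cong)
    moreover have "real k * 0 ^ (k - 1) = q_number q k * 0 ^ (k - 1)" for k
      using assms by (cases "k \<le> 1") (auto simp: q_number_def le_Suc_eq power_0_left)
    ultimately show ?thesis
      using True by (simp only: jackson_deriv_def DERIV_imp_deriv if_True refl)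
  next
    case False
    have "((q * x) ^ k - x ^ k) / (q * x - x) = q_number q k * x ^ (k - 1)" for k
    proof (cases k)
      case 0
      then show ?thesis by (simp add: q_number_def)
    next
      case (Suc m)
      have "q * x - x \<noteq> 0" "1 - q \<noteq> 0"
        using assms False by auto
      then show ?thesis
        by (simp add: Suc q_number_def power_mult_distrib frac_eq_eq) (simp add: algebra_simps)
    qed
    then have "c k * (((q * x) ^ k - x ^ k) / (q * x - x)) =
               c k * (q_number q k * x ^ (k - 1))" for k
      by simp
    then show ?thesis
      using False
      by (simp add: jackson_deriv_def sum_subtractf [symmetric] sum_divide_distrib
            right_diff_distrib [symmetric])
  qed
qed

end

theory Submission
  imports Defs
begin

text \<open>
  Comparing coefficients, the equation holds on polynomials of degree at most \<open>n\<close> iff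
  \<open>[\<nu> + 1] ([\<nu>] + \<alpha> + 1) a\<^bsub>\<nu>+1\<^esub> = ([\<nu>] - [n]) a\<^sub>\<nu>\<close> for all \<open>\<nu> < n\<close>, which the given
  coefficients satisfy. Under this recurrence the operator applied to the truncation
  of \<open>y\<close> at degree \<open>m\<close> telescopes to the single term \<open>([n] - [m]) a\<^sub>m x\<^sup>m\<close>, which vanishes
  for \<open>m = n\<close>.
\<close>

lemma q_number_0 [simp]: "q_number q 0 = 0"
  by (simp add: q_number_def)

lemma q_number_1: "q \<noteq> 1 \<Longrightarrow> q_number q (Suc 0) = 1"
  by (simp add: q_number_def)

text \<open>The geometric sum shows the sign of \<open>q_number\<close> for q < 1 and q > 1 alike,
  whereas in the quotient both numerator and denominator change sign.\<close>

lemma q_number_eq_sum: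
  assumes "q \<noteq> 1"
  shows "q_number q j = (\<Sum>i<j. q ^ i)"
  using assms by (simp add: q_number_def sum_gp_strict)

lemma q_number_nonneg: "q > 0 \<Longrightarrow> q \<noteq> 1 \<Longrightarrow> q_number q j \<ge> 0"
  by (simp add: q_number_eq_sum sum_nonneg)

lemma q_number_pos: "q > 0 \<Longrightarrow> q \<noteq> 1 \<Longrightarrow> j > 0 \<Longrightarrow> q_number q j > 0"
  by (auto simp: q_number_eq_sum intro!: sum_pos)

lemma x_jackson_deriv2_sum:
  assumes "q \<noteq> 1"
  shows "x * jackson_deriv q (jackson_deriv q (\<lambda>x. \<Sum>k\<le>n. c k * x ^ k)) x =
         (\<Sum>k\<le>n. c k * q_number q k * q_number q (k - 1) * x ^ (k - 1))"
proof (cases n)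
  case 0
  then show ?thesis
    \<comment> \<open>The first derivative is the zero function, differentiated again as a sum with
      zero coefficient.\<close>
    using jackson_deriv_sum [OF assms, where n = 0 and c = c]
      jackson_deriv_sum [OF assms, where n = 0 and c = "\<lambda>_. 0"]
    by simp
next
  case (Suc m)
  \<comment> \<open>Shifting the index restores the form \<open>c k * x ^ k\<close>, so that
    \<open>jackson_deriv_sum\<close> applies a second time.\<close>
  have D: "jackson_deriv q (\<lambda>x. \<Sum>k\<le>n. c k * x ^ k) =
        (\<lambda>x. \<Sum>k\<le>m. (c (Suc k) * q_number q (Suc k)) * x ^ k)"
    unfolding jackson_deriv_sum [OF assms]
    by (simp add: Suc sum.atMost_Suc_shift mult.assoc del: sum.atMost_Suc)
  \<comment> \<open>For k = 0 the truncated exponent is harmless because [0] = 0.\<close>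
  have "x * (q_number q k * x ^ (k - 1)) = q_number q k * x ^ k" for k
    by (cases k) auto
  then have *: "x * (b * (q_number q k * x ^ (k - 1))) = b * q_number q k * x ^ k" for b k
    by (simp add: mult.left_commute mult.assoc)
  show ?thesis
    unfolding D jackson_deriv_sum [OF assms] sum_distrib_left *
    by (simp add: Suc sum.atMost_Suc_shift del: sum.atMost_Suc)
qed

lemma laguerre_truncation_telescopes:
  fixes c :: "nat \<Rightarrow> real"
  assumes rec: "\<And>k. k < n \<Longrightarrow>
      q_number q (Suc k) * (q_number q k + \<alpha> + 1) * c (Suc k) =
      (q_number q k - q_number q n) * c k"
    and "m \<le> n"
  shows "(\<Sum>k\<le>m. c k * q_number q k * q_number q (k - 1) * x ^ (k - 1)) +
         (\<alpha> + 1 - x) * (\<Sum>k\<le>m. c k * (q_number q k * x ^ (k - 1))) +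
         q_number q n * (\<Sum>k\<le>m. c k * x ^ k) =
         (q_number q n - q_number q m) * c m * x ^ m"
  using \<open>m \<le> n\<close>
proof (induction m)
  case 0
  then show ?case by simp
next
  case (Suc m)
  \<comment> \<open>The new coefficient contributes this term in degree m, cancelling the remainder
    from the induction hypothesis; its degree m + 1 part is the new remainder.\<close>
  have r: "q_number q (Suc m) * (q_number q m + \<alpha> + 1) * c (Suc m) * x ^ m =
      (q_number q m - q_number q n) * c m * x ^ m"
    using rec [of m] Suc.prems by simp
  show ?case
    using Suc.IH Suc.prems r by (simp add: algebra_simps)
qed

theorem corollary5:
  fixes q \<alpha> :: real and n :: nat and a :: "nat \<Rightarrow> real" and y :: "real \<Rightarrow> real"
  assumes "q > 0" and "q \<noteq> 1" and "\<alpha> > -1" and "n \<ge> 1"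
    and "a 0 \<noteq> 0"
    and "a 1 = - (q_number q n / (\<alpha> + 1)) * a 0"
    and "\<And>\<nu>. 2 \<le> \<nu> \<Longrightarrow> \<nu> \<le> n \<Longrightarrow>
           a \<nu> = - (q_number q n / (\<alpha> + 1)) * a 0 *
             (\<Prod>j = 1..\<nu> - 1. (q_number q j - q_number q n) /
                (q_number q (j + 1) * (q_number q j + \<alpha> + 1)))"
    and "y = (\<lambda>x. \<Sum>\<nu> = 0..n. a \<nu> * x ^ \<nu>)"
  shows "\<forall>x. x * jackson_deriv q (jackson_deriv q y) x
             + (\<alpha> + 1 - x) * jackson_deriv q y x + q_number q n * y x = 0"
proof -
  have rec: "q_number q (Suc k) * (q_number q k + \<alpha> + 1) * a (Suc k) =
      (q_number q k - q_number q n) * a k" if "k < n" for k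
  proof -
    \<comment> \<open>Here [k] \<ge> 0 and \<alpha> + 1 > 0, so the recurrence may be proved in
      divided form.\<close>
    have nz: "q_number q (Suc k) \<noteq> 0" "q_number q k + \<alpha> + 1 \<noteq> 0"
      using q_number_pos [OF assms(1,2), of "Suc k"] q_number_nonneg [OF assms(1,2), of k] assms(3)
      by auto
    consider "k = 0" | "k = 1" | "k \<ge> 2" by linarith
    then have "a (Suc k) = a k * ((q_number q k - q_number q n) /
        (q_number q (Suc k) * (q_number q k + \<alpha> + 1)))"
    proof cases
      case 1
      then show ?thesis
        using assms(6) by (simp add: q_number_1 [OF assms(2)])
    next
      case 2
      then show ?thesis
        using assms(6) assms(7) [of 2] that by (simp add: numeral_2_eq_2)
    next
      case 3
      \<comment> \<open>With k = i + 1 the products for \<open>a k\<close> and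
        \<open>a (Suc k)\<close> end at i and i + 1, so they differ by exactly the factor j =
        k.\<close>
      then obtain i where i: "k = Suc i" by (cases k) auto
      show ?thesis
        using assms(7) [of k] assms(7) [of "Suc k"] 3 that by (simp add: i)
    qed
    then show ?thesis
      using nz by simp
  qed
  have y: "y = (\<lambda>x. \<Sum>k\<le>n. a k * x ^ k)"
    using assms(8) by (simp add: atLeast0AtMost)
  show ?thesis
    using laguerre_truncation_telescopes [OF rec order_refl]
    unfolding y x_jackson_deriv2_sum [OF assms(2)]
    by (simp add: jackson_deriv_sum [OF assms(2)])
qed

end
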